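(* Let $0<\mu\le 1$, $h>0$, let $n\ge 1$ be an integer, and put $J=\{0,1,\dots,n\}$. Let $p,q,r:J\to\mathbb{R}$ with $p(t)>0$ and $r(t)>0$ for all $t\in J$. Then the discrete fractional Sturm-Liouville operator $L_2$ acting on $\ell^2(J)$ by $$L_2x(t)=\Delta_-^{\mu}\big(p(t)\Delta_+^{\mu}x(t)\big)+q(t)x(t),\qquad t\in J,$$ is self-adjoint, i.e. $\langle L_2u,v\rangle=\langle u,L_2v\rangle$ for all $u,v\in\ell^2(J)$.
   Context: $\ell^2(J)$ is the space of functions $x:J\to\mathbb{C}$ with inner product $\langle u,v\rangle=\sum_{s=0}^{n}u(s)\overline{v(s)}$. The (Grünwald-Letnikov) delta left and right fractional differences of order $\mu$ of a function $x:J\to\mathbb{C}$ are, for $t\in J$, $$\Delta_-^{\mu}x(t)=\frac{1}{h^{\mu}}\sum_{s=0}^{t}(-1)^s\frac{\mu(\mu-1)\cdots(\mu-s+1)}{s!}x(t-s),$$ $$\Delta_+^{\mu}x(t)=\frac{1}{h^{\mu}}\sum_{s=0}^{n-t}(-1)^s\frac{\mu(\mu-1)\cdots(\mu-s+1)}{s!}x(t+s),$$ where the coefficient for $s=0$ is $1$. The expression $\Delta_-^{\mu}(p(t)\Delta_+^{\mu}x(t))$ means $\Delta_-^\mu$ applied to the function $t\mapsto p(t)\cdot(\Delta_+^\mu x)(t)$ on $J$. *)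

theory Defs
  imports Complex_Main "HOL-Library.FuncSet"
begin

text \<open>
  Functions on \<open>J = {0,\<dots>,n}\<close> are represented by functions on \<^typ>\<open>nat\<close> that are extensional
  on \<open>{0..n}\<close>; only their values on \<open>{0..n}\<close> enter below.
\<close>

definition l2 :: "nat \<Rightarrow> (nat \<Rightarrow> complex) set" where
  "l2 n = {0..n} \<rightarrow>\<^sub>E UNIV"

definition l2_inner :: "nat \<Rightarrow> (nat \<Rightarrow> complex) \<Rightarrow> (nat \<Rightarrow> complex) \<Rightarrow> complex" where
  "l2_inner n u v = (\<Sum>s = 0..n. u s * cnj (v s))"

text \<open>
  The coefficient \<open>\<mu> (\<mu> - 1) \<cdots> (\<mu> - s + 1) / s!\<close> is the generalized binomial coefficient
  \<open>\<mu> gchoose s\<close>. The differences are meant for \<open>h > 0\<close> and \<open>t \<le> n\<close>.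
\<close>

definition delta_left :: "real \<Rightarrow> real \<Rightarrow> (nat \<Rightarrow> complex) \<Rightarrow> nat \<Rightarrow> complex" where
  "delta_left h \<mu> x t =
     of_real (1 / h powr \<mu>) * (\<Sum>s = 0..t. of_real ((-1) ^ s * (\<mu> gchoose s)) * x (t - s))"

definition delta_right :: "nat \<Rightarrow> real \<Rightarrow> real \<Rightarrow> (nat \<Rightarrow> complex) \<Rightarrow> nat \<Rightarrow> complex" where
  "delta_right n h \<mu> x t =
     of_real (1 / h powr \<mu>) * (\<Sum>s = 0..n - t. of_real ((-1) ^ s * (\<mu> gchoose s)) * x (t + s))"

definition L2_op ::
    "nat \<Rightarrow> real \<Rightarrow> real \<Rightarrow> (nat \<Rightarrow> real) \<Rightarrow> (nat \<Rightarrow> real) \<Rightarrow> (nat \<Rightarrow> complex) \<Rightarrow> nat \<Rightarrow> complex" where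
  "L2_op n h \<mu> p q x =
     (\<lambda>t\<in>{0..n}. delta_left h \<mu> (\<lambda>s. of_real (p s) * delta_right n h \<mu> x s) t + of_real (q t) * x t)"

lemma L2_op_in_l2: "L2_op n h \<mu> p q x \<in> l2 n"
  by (simp add: L2_op_def l2_def)

definition self_adjoint_l2 :: "nat \<Rightarrow> ((nat \<Rightarrow> complex) \<Rightarrow> nat \<Rightarrow> complex) \<Rightarrow> bool" where
  "self_adjoint_l2 n T \<longleftrightarrow>
     (\<forall>u\<in>l2 n. \<forall>v\<in>l2 n. l2_inner n (T u) v = l2_inner n u (T v))"

end

(* The left and right fractional differences are adjoint to each other, because their
   matrices (lower and upper triangular Toeplitz, with real entries) are transposes.  Hence
   <L_2 u, v> = <p D u, D v> + <q u, v>, where D is the right difference, and this form is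
   Hermitian since p and q are real. *)
theory Submission
  imports Defs
begin

lemma l2_inner_add_left: "l2_inner n (\<lambda>t. u t + w t) v = l2_inner n u v + l2_inner n w v"
  by (simp add: l2_inner_def sum.distrib distrib_right)

lemma l2_inner_restrict_left: "l2_inner n (restrict u {0..n}) v = l2_inner n u v"
  by (simp add: l2_inner_def)

lemma cnj_l2_inner: "cnj (l2_inner n u v) = l2_inner n v u"
  by (simp add: l2_inner_def mult.commute)

text \<open>Conjugation fixes the real weight, so it may sit in either argument.\<close>

lemma l2_inner_real_mult:
  "l2_inner n (\<lambda>t. of_real (p t) * u t) v = l2_inner n u (\<lambda>t. of_real (p t) * v t)"
  by (simp add: l2_inner_def mult_ac)

text \<open>Substituting \<open>k = t - s\<close> exposes a convolution kernel that depends on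
  \<open>t - k\<close> only.\<close>

lemma delta_left_reindex:
  "delta_left h \<mu> x t =
     of_real (1 / h powr \<mu>) * (\<Sum>k = 0..t. of_real ((-1) ^ (t - k) * (\<mu> gchoose (t - k))) * x k)"
  unfolding delta_left_def
  by (subst sum.atLeastAtMost_rev) simp

text \<open>The bound is essential: for \<open>t > n\<close> truncated subtraction leaves the term
  \<open>x t\<close> on the left, while \<open>{t..n}\<close> is empty.\<close>

lemma delta_right_reindex:
  assumes "t \<le> n"
  shows "delta_right n h \<mu> x t =
     of_real (1 / h powr \<mu>) * (\<Sum>k = t..n. of_real ((-1) ^ (k - t) * (\<mu> gchoose (k - t))) * x k)"
proof -
  have "(\<Sum>s = 0..n - t. of_real ((-1) ^ s * (\<mu> gchoose s)) * x (t + s))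
      = (\<Sum>k = t..n. of_real ((-1) ^ (k - t) * (\<mu> gchoose (k - t))) * x k)"
    using assms
    by (intro sum.reindex_bij_witness[of _ "\<lambda>k. k - t" "\<lambda>s. t + s"]) auto
  then show ?thesis
    by (simp add: delta_right_def)
qed

lemma l2_inner_delta_left:
  "l2_inner n (delta_left h \<mu> u) v = l2_inner n u (delta_right n h \<mu> v)"
proof -
  define a where "a s = of_real (1 / h powr \<mu>) * complex_of_real ((-1) ^ s * (\<mu> gchoose s))" for s
  \<comment> \<open>The condition \<open>k \<le> t\<close> is kept as a filter on
    \<open>{0..n}\<close>, so that the triangle can be summed in the other order.\<close>
  have "l2_inner n (delta_left h \<mu> u) v
      = (\<Sum>t\<in>{0..n}. \<Sum>k | k \<in> {0..n} \<and> k \<le> t. a (t - k) * u k * cnj (v t))"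
    unfolding l2_inner_def delta_left_reindex sum_distrib_left sum_distrib_right
    by (intro sum.cong) (auto simp: a_def)
  also have "\<dots> = (\<Sum>k\<in>{0..n}. \<Sum>t | t \<in> {0..n} \<and> k \<le> t. a (t - k) * u k * cnj (v t))"
    by (rule sum.swap_restrict) auto
  also have "\<dots> = (\<Sum>k\<in>{0..n}. u k * cnj (delta_right n h \<mu> v k))"
  proof (rule sum.cong[OF refl])
    fix k assume k: "k \<in> {0..n}"
    then have "{t. t \<in> {0..n} \<and> k \<le> t} = {k..n}"
      by auto
    \<comment> \<open>Column \<open>k\<close> of the lower triangle is row \<open>k\<close> of the
      right difference; \<open>cnj\<close> leaves \<open>a\<close> unchanged because its values are
      real.\<close>
    with k show "(\<Sum>t | t \<in> {0..n} \<and> k \<le> t. a (t - k) * u k * cnj (v t))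
        = u k * cnj (delta_right n h \<mu> v k)"
      by (simp add: delta_right_reindex a_def sum_distrib_left mult_ac)
  qed
  finally show ?thesis
    by (simp add: l2_inner_def)
qed

text \<open>Moving the outer left difference onto \<open>v\<close> leaves a form treating
  \<open>u\<close> and \<open>v\<close> alike, except for the side carrying the weights.\<close>

lemma l2_inner_L2_op:
  "l2_inner n (L2_op n h \<mu> p q u) v =
     l2_inner n (\<lambda>t. of_real (p t) * delta_right n h \<mu> u t) (delta_right n h \<mu> v)
     + l2_inner n (\<lambda>t. of_real (q t) * u t) v"
  by (simp only: L2_op_def l2_inner_restrict_left l2_inner_add_left l2_inner_delta_left)

theorem theorem12:
  fixes \<mu> h :: real and n :: nat and p q r :: "nat \<Rightarrow> real"
  assumes "0 < \<mu>" and "\<mu> \<le> 1"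
    and "h > 0"
    and "n \<ge> 1"
    and "\<forall>t\<in>{0..n}. p t > 0"
    and "\<forall>t\<in>{0..n}. r t > 0"
  shows "self_adjoint_l2 n (L2_op n h \<mu> p q)"
  unfolding self_adjoint_l2_def
proof (intro ballI)
  fix u v :: "nat \<Rightarrow> complex"
  let ?L = "L2_op n h \<mu> p q"
  \<comment> \<open>Expanding both sides as forms, conjugation swaps the arguments back and the
    weights change sides.\<close>
  have "l2_inner n (?L u) v = cnj (l2_inner n (?L v) u)"
    by (simp only: l2_inner_L2_op complex_cnj_add cnj_l2_inner l2_inner_real_mult)
  then show "l2_inner n (?L u) v = l2_inner n u (?L v)"
    by (simp only: cnj_l2_inner)
qed

end
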